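(* Let $M$ be a quaternary matroid on ground set $V$, and let $B$ be any representation of $M$ over $\mathrm{GF}(4)$. Then for every $Y\subseteq V$, the matroid $M(\mathrm{BC}_{\ker(B)}(Y))$ equals the matroid $\max(M+Y)$.
   Context: A representation of $M$ over $\mathrm{GF}(4)$ is a matrix $B$ over $\mathrm{GF}(4)$ with columns indexed by $V$ whose column matroid is $M$; $\ker(B)=\{v\in\mathrm{GF}(4)^V: Bv=0\}$. $\mathrm{inv}$ is the nontrivial automorphism $x\mapsto x^2$ of $\mathrm{GF}(4)$, applied entrywise to vectors and subspaces. For a subspace $L\subseteq\mathrm{GF}(4)^V$: $L^\perp=\{v:\sum_{x\in V}u(x)v(x)=0\ \forall u\in L\}$; $\pi_Y(v)$ sets the entries of $v$ outside $Y$ to $0$; $\mathrm{BC}_L(Y)=\{v\in L\mid \pi_Y(v)\in\mathrm{inv}(L^\perp)\}$; $M(L)$ is the matroid on $V$ whose circuits are the inclusion-minimal nonempty sets $C\subseteq V$ that are supports of vectors in $L$. Matroids are identified with the set system $(V,\mathcal{B})$ of their bases. For a set system $N=(V,D)$ and $Y\subseteq V$, the loop complementation $N+Y=(V,D')$ where $Z\in D'$ iff the number of $W\in D$ with $Z\setminus Y\subseteq W\subseteq Z$ is odd; $\max(N)=(V,\text{inclusion-maximal members of }D)$, here a matroid given by its bases. *)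

theory Defs
  imports "HOL-Library.Z2"
begin

text \<open>GF(4) as GF(2)[w]/(w^2 + w + 1): \<open>GF4 a b\<close> stands for a + b w.\<close>

datatype gf4 = GF4 bit bit

lemma gf4_cases:
  obtains "x = GF4 0 0" | "x = GF4 0 1" | "x = GF4 1 0" | "x = GF4 1 1"
  by (cases x) (metis bit.exhaust)

instantiation gf4 :: field
begin

definition zero_gf4 :: gf4 where "0 = GF4 0 0"
definition one_gf4 :: gf4 where "1 = GF4 1 0"

fun plus_gf4 :: "gf4 \<Rightarrow> gf4 \<Rightarrow> gf4" where
  "GF4 a b + GF4 c d = GF4 (a + c) (b + d)"

definition uminus_gf4 :: "gf4 \<Rightarrow> gf4" where "- x = (x :: gf4)"
definition minus_gf4 :: "gf4 \<Rightarrow> gf4 \<Rightarrow> gf4" where "x - y = x + (y :: gf4)"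

fun times_gf4 :: "gf4 \<Rightarrow> gf4 \<Rightarrow> gf4" where
  "GF4 a b * GF4 c d = GF4 (a * c + b * d) (a * d + b * c + b * d)"

text \<open>Nonzero elements satisfy x^3 = 1.\<close>
definition inverse_gf4 :: "gf4 \<Rightarrow> gf4" where "inverse x = x * (x :: gf4)"
definition divide_gf4 :: "gf4 \<Rightarrow> gf4 \<Rightarrow> gf4" where "x div y = x * inverse (y :: gf4)"

instance
proof
  fix x y z :: gf4
  note defs = zero_gf4_def one_gf4_def uminus_gf4_def minus_gf4_def inverse_gf4_def
  show "x + y + z = x + (y + z)"
    by (cases x rule: gf4_cases; cases y rule: gf4_cases; cases z rule: gf4_cases; simp)
  show "x + y = y + x" by (cases x rule: gf4_cases; cases y rule: gf4_cases; simp)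
  show "0 + x = x" by (cases x) (simp add: defs)
  show "- x + x = 0" by (cases x rule: gf4_cases; simp add: defs)
  show "x - y = x + - y" by (simp add: defs)
  show "x * y * z = x * (y * z)"
    by (cases x rule: gf4_cases; cases y rule: gf4_cases; cases z rule: gf4_cases; simp)
  show "x * y = y * x" by (cases x rule: gf4_cases; cases y rule: gf4_cases; simp)
  show "1 * x = x" by (cases x rule: gf4_cases; simp add: defs)
  show "(x + y) * z = x * z + y * z"
    by (cases x rule: gf4_cases; cases y rule: gf4_cases; cases z rule: gf4_cases; simp)
  show "(0 :: gf4) \<noteq> 1" by (simp add: defs)
  show "x \<noteq> 0 \<Longrightarrow> inverse x * x = 1" by (cases x rule: gf4_cases; simp add: defs)
  show "x div y = x * inverse y" by (simp add: divide_gf4_def)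
  show "inverse (0 :: gf4) = 0" by (simp add: zero_gf4_def inverse_gf4_def)
qed

end

lemma card_gf4: "card (UNIV :: gf4 set) = 4"
proof -
  have "x \<in> {GF4 0 0, GF4 0 1, GF4 1 0, GF4 1 1}" for x
    by (cases x rule: gf4_cases) simp_all
  then have UNIV: "UNIV = {GF4 0 0, GF4 0 1, GF4 1 0, GF4 1 1}" by (rule UNIV_eq_I)
  show ?thesis by (subst UNIV) simp
qed

text \<open>A set system is a pair of ground set and family of members; a matroid is the set system of
  its bases.\<close>

type_synonym 'v set_system = "'v set \<times> 'v set set"

abbreviation ground :: "'v set_system \<Rightarrow> 'v set" where "ground \<equiv> fst"
abbreviation members :: "'v set_system \<Rightarrow> 'v set set" where "members \<equiv> snd"

definition maximal_sets :: "'v set set \<Rightarrow> 'v set set" where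
  "maximal_sets D = {X \<in> D. \<forall>Z\<in>D. X \<subseteq> Z \<longrightarrow> Z = X}"

definition minimal_sets :: "'v set set \<Rightarrow> 'v set set" where
  "minimal_sets D = {X \<in> D. \<forall>Z\<in>D. Z \<subseteq> X \<longrightarrow> Z = X}"

definition max_sys :: "'v set_system \<Rightarrow> 'v set_system" where
  "max_sys N = (ground N, maximal_sets (members N))"

definition loop_compl :: "'v set_system \<Rightarrow> 'v set \<Rightarrow> 'v set_system" where
  "loop_compl N Y =
     (ground N, {Z. Z \<subseteq> ground N \<and> odd (card {W \<in> members N. Z - Y \<subseteq> W \<and> W \<subseteq> Z})})"

definition matroid :: "'v set_system \<Rightarrow> bool" where
  "matroid M \<longleftrightarrow> finite (ground M) \<and> members M \<subseteq> Pow (ground M) \<and> members M \<noteq> {} \<and>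
     (\<forall>X\<in>members M. \<forall>Z\<in>members M. \<forall>x\<in>X - Z. \<exists>y\<in>Z - X. insert y (X - {x}) \<in> members M)"

definition circuits :: "'v set_system \<Rightarrow> 'v set set" where
  "circuits M = minimal_sets {X. X \<subseteq> ground M \<and> \<not> (\<exists>W\<in>members M. X \<subseteq> W)}"

definition matroid_of_circuits :: "'v set \<Rightarrow> 'v set set \<Rightarrow> 'v set_system" where
  "matroid_of_circuits V \<C> = (V, maximal_sets {I. I \<subseteq> V \<and> (\<forall>C\<in>\<C>. \<not> C \<subseteq> I)})"


text \<open>A matrix with rows indexed by a finite set \<open>R\<close> and columns by \<open>V\<close> is a function
  \<open>B :: 'r \<Rightarrow> 'v \<Rightarrow> 'k\<close> of which only the values on \<open>R \<times> V\<close> matter. Vectors in \<open>'k\<^sup>V\<close> are functions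
  vanishing outside \<open>V\<close>.\<close>

definition columns_independent :: "'r set \<Rightarrow> ('r \<Rightarrow> 'v \<Rightarrow> 'k::field) \<Rightarrow> 'v set \<Rightarrow> bool" where
  "columns_independent R B S \<longleftrightarrow>
     (\<forall>c. (\<forall>r\<in>R. (\<Sum>x\<in>S. c x * B r x) = 0) \<longrightarrow> (\<forall>x\<in>S. c x = 0))"

definition column_matroid :: "'r set \<Rightarrow> 'v set \<Rightarrow> ('r \<Rightarrow> 'v \<Rightarrow> 'k::field) \<Rightarrow> 'v set_system" where
  "column_matroid R V B = (V, maximal_sets {S. S \<subseteq> V \<and> columns_independent R B S})"

definition representation :: "'r set \<Rightarrow> ('r \<Rightarrow> 'v \<Rightarrow> 'k::field) \<Rightarrow> 'v set_system \<Rightarrow> bool" where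
  "representation R B M \<longleftrightarrow> finite R \<and> column_matroid R (ground M) B = M"

definition quaternary :: "'v set_system \<Rightarrow> bool" where
  "quaternary M \<longleftrightarrow> matroid M \<and>
     (\<exists>(m::nat) (B :: nat \<Rightarrow> 'v \<Rightarrow> gf4). representation {..<m} B M)"

definition vecs :: "'v set \<Rightarrow> ('v \<Rightarrow> 'k::field) set" where
  "vecs V = {v. \<forall>x. x \<notin> V \<longrightarrow> v x = 0}"

definition ker_mat :: "'r set \<Rightarrow> 'v set \<Rightarrow> ('r \<Rightarrow> 'v \<Rightarrow> 'k::field) \<Rightarrow> ('v \<Rightarrow> 'k) set" where
  "ker_mat R V B = {v \<in> vecs V. \<forall>r\<in>R. (\<Sum>x\<in>V. B r x * v x) = 0}"

definition inv_gf4 :: "gf4 \<Rightarrow> gf4" where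
  "inv_gf4 x = x\<^sup>2"

definition inv_space :: "('v \<Rightarrow> gf4) set \<Rightarrow> ('v \<Rightarrow> gf4) set" where
  "inv_space L = (\<lambda>v. inv_gf4 \<circ> v) ` L"

definition perp :: "'v set \<Rightarrow> ('v \<Rightarrow> 'k::field) set \<Rightarrow> ('v \<Rightarrow> 'k) set" where
  "perp V L = {v \<in> vecs V. \<forall>u\<in>L. (\<Sum>x\<in>V. u x * v x) = 0}"

definition proj :: "'v set \<Rightarrow> ('v \<Rightarrow> 'k::field) \<Rightarrow> 'v \<Rightarrow> 'k" where
  "proj Y v = (\<lambda>x. if x \<in> Y then v x else 0)"

definition BC :: "'v set \<Rightarrow> ('v \<Rightarrow> gf4) set \<Rightarrow> 'v set \<Rightarrow> ('v \<Rightarrow> gf4) set" where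
  "BC V L Y = {v \<in> L. proj Y v \<in> inv_space (perp V L)}"

definition support :: "('v \<Rightarrow> 'k::field) \<Rightarrow> 'v set" where
  "support v = {x. v x \<noteq> 0}"

definition space_circuits :: "'v set \<Rightarrow> ('v \<Rightarrow> 'k::field) set \<Rightarrow> 'v set set" where
  "space_circuits V L = minimal_sets {C. C \<subseteq> V \<and> C \<noteq> {} \<and> (\<exists>v\<in>L. C = support v)}"

definition matroid_of_space :: "'v set \<Rightarrow> ('v \<Rightarrow> 'k::field) set \<Rightarrow> 'v set_system" where
  "matroid_of_space V L = matroid_of_circuits V (space_circuits V L)"

text \<open>For finite \<open>V\<close>, \<open>matroid_of_space V L\<close> has exactly the prescribed circuits.\<close>

lemma ex_maximal_sets:
  assumes "finite V" "D \<subseteq> Pow V" "X \<in> D"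
  shows "\<exists>W\<in>maximal_sets D. X \<subseteq> W"
proof -
  have "finite D" using assms by (meson finite_Pow_iff finite_subset)
  from finite_has_maximal2[OF this assms(3)]
  obtain W where "W \<in> D" "X \<subseteq> W" "\<forall>Z\<in>D. W \<subseteq> Z \<longrightarrow> W = Z" by auto
  then have "W \<in> maximal_sets D" by (auto simp: maximal_sets_def)
  with \<open>X \<subseteq> W\<close> show ?thesis by auto
qed

lemma circuits_matroid_of_space:
  assumes "finite V"
  shows "circuits (matroid_of_space V L) = space_circuits V L"
proof -
  let ?C = "space_circuits V L"
  have sub: "C \<subseteq> V" if "C \<in> ?C" for C
    using that by (auto simp: space_circuits_def minimal_sets_def)
  have anti: "C = C'" if "C \<in> ?C" "C' \<in> ?C" "C \<subseteq> C'" for C C'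
    using that by (auto simp: space_circuits_def minimal_sets_def)
  have dep: "(\<exists>W\<in>members (matroid_of_space V L). X \<subseteq> W) \<longleftrightarrow> (\<forall>C\<in>?C. \<not> C \<subseteq> X)"
    if "X \<subseteq> V" for X
  proof
    assume "\<exists>W\<in>members (matroid_of_space V L). X \<subseteq> W"
    then obtain W where "X \<subseteq> W" "\<forall>C\<in>?C. \<not> C \<subseteq> W"
      by (auto simp: matroid_of_space_def matroid_of_circuits_def maximal_sets_def)
    then show "\<forall>C\<in>?C. \<not> C \<subseteq> X" by (meson subset_trans)
  next
    assume "\<forall>C\<in>?C. \<not> C \<subseteq> X"
    with that have "X \<in> {I. I \<subseteq> V \<and> (\<forall>C\<in>?C. \<not> C \<subseteq> I)}" by simp
    from ex_maximal_sets[OF assms _ this]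
    show "\<exists>W\<in>members (matroid_of_space V L). X \<subseteq> W"
      by (simp add: matroid_of_space_def matroid_of_circuits_def Collect_mono Pow_def)
  qed
  have g: "ground (matroid_of_space V L) = V"
    by (simp add: matroid_of_space_def matroid_of_circuits_def)
  have eq: "{X. X \<subseteq> ground (matroid_of_space V L) \<and>
                \<not> (\<exists>W\<in>members (matroid_of_space V L). X \<subseteq> W)} =
             {X. X \<subseteq> V \<and> (\<exists>C\<in>?C. C \<subseteq> X)}"
    unfolding g using dep by (intro Collect_cong conj_cong refl) simp
  show ?thesis
    unfolding circuits_def eq
  proof (intro set_eqI iffI)
    fix X
    assume "X \<in> minimal_sets {X. X \<subseteq> V \<and> (\<exists>C\<in>?C. C \<subseteq> X)}"
    then obtain C where C: "C \<in> ?C" "C \<subseteq> X"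
      and min: "\<And>Z. Z \<subseteq> V \<Longrightarrow> \<exists>C\<in>?C. C \<subseteq> Z \<Longrightarrow> Z \<subseteq> X \<Longrightarrow> Z = X"
      by (auto simp: minimal_sets_def)
    have "C = X" using C(1) by (intro min sub C(2) bexI[of _ C]) simp_all
    with C(1) show "X \<in> ?C" by simp
  next
    fix X
    assume X: "X \<in> ?C"
    show "X \<in> minimal_sets {X. X \<subseteq> V \<and> (\<exists>C\<in>?C. C \<subseteq> X)}"
      unfolding minimal_sets_def
    proof (intro CollectI conjI ballI impI)
      show "X \<subseteq> V" "\<exists>C\<in>?C. C \<subseteq> X" using X sub by auto
      fix Z assume "Z \<in> {X. X \<subseteq> V \<and> (\<exists>C\<in>?C. C \<subseteq> X)}" "Z \<subseteq> X"
      then obtain C where "C \<in> ?C" "C \<subseteq> Z" by blast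
      then show "Z = X" using anti[OF _ X] \<open>Z \<subseteq> X\<close> by blast
    qed
  qed
qed

end

theory Submission
  imports Defs
begin

text \<open>Let \<open>L = ker B\<close>, and call \<open>Z\<close> nonsingular for \<open>Y\<close> if the only \<open>v \<in> L\<close> supported in \<open>Z\<close> and
  \<open>a \<in> inv(L\<^sup>\<bottom>)\<close> such that \<open>a\<close> agrees with \<open>\<pi>\<^sub>Y(v)\<close> on \<open>Z\<close> are \<open>v = a = 0\<close>. For empty \<open>Y\<close> this says that
  \<open>Z\<close> is a basis of \<open>M\<close>. Adding to \<open>Y\<close> an element \<open>y \<in> Z\<close> changes nonsingularity in the same way as loop
  complementation changes membership: \<open>Z\<close> is nonsingular for \<open>Y \<union> {y}\<close> iff exactly one of \<open>Z\<close> and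
  \<open>Z - {y}\<close> is nonsingular for \<open>Y\<close>, because norms of elements of GF(4) lie in GF(2). So the members of
  \<open>M + Y\<close> are the nonsingular sets. A nonsingular set contains no circuit of \<open>M(BC\<^sub>L(Y))\<close>, and
  every basis of \<open>M(BC\<^sub>L(Y))\<close> is nonsingular, as column bases of a Hermitian matrix index nonsingular
  principal submatrices.\<close>

section \<open>Linear spaces and their free sets\<close>

definition free_on :: "('v \<Rightarrow> 'k::field) set \<Rightarrow> 'v set \<Rightarrow> bool" where
  "free_on L I \<longleftrightarrow> (\<forall>v\<in>L. support v \<subseteq> I \<longrightarrow> v = (\<lambda>_. 0))"

abbreviation free_bases :: "'v set \<Rightarrow> ('v \<Rightarrow> 'k::field) set \<Rightarrow> 'v set set" where
  "free_bases V L \<equiv> maximal_sets {I. I \<subseteq> V \<and> free_on L I}"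

lemma support_subset_iff: "support v \<subseteq> I \<longleftrightarrow> (\<forall>x. x \<notin> I \<longrightarrow> v x = 0)"
  by (auto simp: support_def)

lemma free_on_iff_no_circuit:
  assumes "finite V" and "L \<subseteq> vecs V" and "I \<subseteq> V"
  shows "(\<forall>C\<in>space_circuits V L. \<not> C \<subseteq> I) \<longleftrightarrow> free_on L I"
proof
  assume "free_on L I"
  then show "\<forall>C\<in>space_circuits V L. \<not> C \<subseteq> I"
    by (auto simp: space_circuits_def minimal_sets_def free_on_def support_def)
next
  assume no_circuit: "\<forall>C\<in>space_circuits V L. \<not> C \<subseteq> I"
  show "free_on L I"
    unfolding free_on_def
  proof (intro ballI impI, rule ccontr)
    fix v assume v: "v \<in> L" "support v \<subseteq> I" "v \<noteq> (\<lambda>_. 0)"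
    let ?D = "{C. C \<subseteq> V \<and> C \<noteq> {} \<and> (\<exists>v\<in>L. C = support v)}"
    have "finite ?D" by (rule finite_subset[of _ "Pow V"]) (auto simp: assms(1))
    moreover have "support v \<noteq> {}" using v(3) by (auto simp: support_def)
    then have "support v \<in> ?D" using v assms(3) by blast
    ultimately obtain C where C: "C \<in> ?D" "C \<subseteq> support v" "\<forall>Z\<in>?D. Z \<subseteq> C \<longrightarrow> C = Z"
      using finite_has_minimal2[of ?D "support v"] by auto
    then have "C \<in> space_circuits V L"
      unfolding space_circuits_def minimal_sets_def by blast
    with no_circuit C(2) v(2) show False by blast
  qed
qed

lemma members_matroid_of_space:
  assumes "finite V" and "L \<subseteq> vecs V"
  shows "members (matroid_of_space V L) = free_bases V L"
proof -
  have "{I. I \<subseteq> V \<and> (\<forall>C\<in>space_circuits V L. \<not> C \<subseteq> I)} = {I. I \<subseteq> V \<and> free_on L I}"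
    using free_on_iff_no_circuit[OF assms] by blast
  then show ?thesis by (simp add: matroid_of_space_def matroid_of_circuits_def)
qed

text \<open>A dependence among the columns in \<open>S\<close>, extended by 0 to \<open>V\<close>,
  is a kernel vector supported in \<open>S\<close>.\<close>

lemma columns_independent_iff_free_on:
  assumes "finite V" and "S \<subseteq> V"
  shows "columns_independent R B S \<longleftrightarrow> free_on (ker_mat R V B) S"
proof
  assume indep: "columns_independent R B S"
  show "free_on (ker_mat R V B) S"
    unfolding free_on_def
  proof (intro ballI impI)
    fix v assume v: "v \<in> ker_mat R V B" "support v \<subseteq> S"
    have "(\<Sum>x\<in>S. v x * B r x) = (\<Sum>x\<in>V. B r x * v x)" for r
      using v(2) assms by (intro sum.mono_neutral_cong_left) (auto simp: support_def)
    then have "\<forall>r\<in>R. (\<Sum>x\<in>S. v x * B r x) = 0" using v(1) by (simp add: ker_mat_def)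
    then have "\<forall>x\<in>S. v x = 0" using indep by (simp add: columns_independent_def)
    then show "v = (\<lambda>_. 0)" using v(2) by (auto simp: support_subset_iff)
  qed
next
  assume free: "free_on (ker_mat R V B) S"
  show "columns_independent R B S"
    unfolding columns_independent_def
  proof (intro allI impI ballI)
    fix c x assume c: "\<forall>r\<in>R. (\<Sum>x\<in>S. c x * B r x) = 0" and x: "x \<in> S"
    let ?v = "proj S c"
    have "(\<Sum>x\<in>V. B r x * ?v x) = (\<Sum>x\<in>S. c x * B r x)" for r
      using assms by (intro sum.mono_neutral_cong_right) (auto simp: proj_def)
    then have "?v \<in> ker_mat R V B"
      using c assms(2) by (auto simp: ker_mat_def vecs_def proj_def)
    moreover have "support ?v \<subseteq> S" by (simp add: support_subset_iff proj_def)
    ultimately have "?v = (\<lambda>_. 0)" using free by (simp add: free_on_def)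
    then show "c x = 0" using x by (metis proj_def)
  qed
qed

lemma members_column_matroid:
  assumes "finite V"
  shows "members (column_matroid R V B) = free_bases V (ker_mat R V B)"
proof -
  have "{S. S \<subseteq> V \<and> columns_independent R B S} = {S. S \<subseteq> V \<and> free_on (ker_mat R V B) S}"
    using columns_independent_iff_free_on[OF assms] by blast
  then show ?thesis by (simp add: column_matroid_def)
qed

text \<open>A nonzero vector witnessing the maximality of \<open>I\<close> cannot vanish at
  \<open>e\<close>, since its support would then lie in \<open>I\<close>. The lemma stands outside
  the locale because it is also applied to \<open>BC V L Y\<close>, whose linearity is never
  proved.\<close>

lemma free_basis_extend:
  assumes "I \<in> free_bases V L" and "e \<in> V - I"
  obtains v where "v \<in> L" "support v \<subseteq> insert e I" "v e \<noteq> 0"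
proof -
  from assms have free: "free_on L I" and "insert e I \<subseteq> V" "insert e I \<noteq> I"
    and "\<And>Z. Z \<subseteq> V \<Longrightarrow> free_on L Z \<Longrightarrow> I \<subseteq> Z \<Longrightarrow> Z = I"
    by (auto simp: maximal_sets_def)
  then have "\<not> free_on L (insert e I)" by blast
  then obtain v where v: "v \<in> L" "support v \<subseteq> insert e I" "v \<noteq> (\<lambda>_. 0)"
    by (auto simp: free_on_def)
  have "v e \<noteq> 0"
  proof
    assume "v e = 0"
    then have "support v \<subseteq> I" using v(2) by (auto simp: support_def)
    with free v show False by (simp add: free_on_def)
  qed
  with v that show thesis by blast
qed

section \<open>Coordinates of a space and of its dual relative to a basis\<close>

locale linear_space =
  fixes V :: "'v set" and L :: "('v \<Rightarrow> 'k::field) set"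
  assumes fin: "finite V" and sub: "L \<subseteq> vecs V"
    and zero: "(\<lambda>_. 0) \<in> L"
    and comb: "u \<in> L \<Longrightarrow> v \<in> L \<Longrightarrow> (\<lambda>x. u x + c * v x) \<in> L"
begin

lemma eq_0_outside: "v \<in> L \<Longrightarrow> x \<notin> V \<Longrightarrow> v x = 0"
  using sub by (auto simp: vecs_def)

lemma scale: "v \<in> L \<Longrightarrow> (\<lambda>x. c * v x) \<in> L"
  using comb[OF zero] by simp

lemma sum_mem:
  assumes "finite E" and "\<And>e. e \<in> E \<Longrightarrow> w e \<in> L"
  shows "(\<lambda>x. \<Sum>e\<in>E. f e * w e x) \<in> L"
  using assms
proof (induction E rule: finite_induct)
  case empty
  then show ?case by (simp add: zero)
next
  case (insert e E)
  then have "(\<lambda>x. (\<Sum>e\<in>E. f e * w e x) + f e * w e x) \<in> L" by (intro comb) auto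
  then show ?case using insert by (simp add: add.commute)
qed

lemma fundamental_vectors:
  assumes "I \<in> free_bases V L"
  obtains w where "\<And>e. e \<in> V - I \<Longrightarrow> w e \<in> L"
    "\<And>e. e \<in> V - I \<Longrightarrow> support (w e) \<subseteq> insert e I"
    "\<And>e. e \<in> V - I \<Longrightarrow> w e e = 1"
proof -
  have "\<exists>w\<in>L. support w \<subseteq> insert e I \<and> w e = 1" if e: "e \<in> V - I" for e
  proof -
    obtain v where v: "v \<in> L" "support v \<subseteq> insert e I" "v e \<noteq> 0"
      using free_basis_extend[OF assms e] .
    show ?thesis
      by (rule bexI[OF _ scale[OF v(1), of "inverse (v e)"]])
        (use v in \<open>auto simp: support_subset_iff\<close>)
  qed
  then show thesis using that by metis
qed

text \<open>Restricted to \<open>V - I\<close>, the fundamental vectors are the unit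
  vectors.\<close>

lemma ex_prescribed_off_basis:
  assumes I: "I \<in> free_bases V L"
  shows "\<exists>v\<in>L. \<forall>x\<in>V - I. v x = f x"
proof -
  obtain w where w: "\<And>e. e \<in> V - I \<Longrightarrow> w e \<in> L"
    "\<And>e. e \<in> V - I \<Longrightarrow> support (w e) \<subseteq> insert e I"
    "\<And>e. e \<in> V - I \<Longrightarrow> w e e = 1"
    using fundamental_vectors[OF I] by metis
  show ?thesis
  proof (intro bexI ballI)
    show "(\<lambda>x. \<Sum>e\<in>V - I. f e * w e x) \<in> L" by (rule sum_mem) (use fin w in auto)
    fix x assume x: "x \<in> V - I"
    have "(\<Sum>e\<in>V - I. f e * w e x) = (\<Sum>e\<in>V - I. if e = x then f x else 0)"
      using w x by (intro sum.cong) (auto simp: support_subset_iff)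
    then show "(\<Sum>e\<in>V - I. f e * w e x) = f x" using x fin by simp
  qed
qed

lemma eq_if_eq_off_basis:
  assumes I: "I \<in> free_bases V L" and u: "u \<in> L" and v: "v \<in> L"
    and eq: "\<And>x. x \<in> V - I \<Longrightarrow> u x = v x"
  shows "u = v"
proof -
  let ?d = "\<lambda>x. u x + (- 1) * v x"
  have "?d x = 0" if "x \<notin> I" for x
    using that eq[of x] u v by (cases "x \<in> V") (auto simp: eq_0_outside)
  then have "support ?d \<subseteq> I" by (simp add: support_subset_iff)
  moreover have "?d \<in> L" by (rule comb[OF u v])
  ultimately have "?d = (\<lambda>_. 0)" using I by (auto simp: maximal_sets_def free_on_def)
  then show ?thesis by (auto simp: fun_eq_iff)
qed

text \<open>The dual standard form: the fundamental vectors span \<open>L\<close>, so orthogonality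
  to them suffices, and as \<open>w e e = 1\<close>, each such condition can be solved for the entry
  of \<open>a\<close> at \<open>e\<close>.\<close>

lemma ex_perp_prescribed_on_basis:
  assumes I: "I \<in> free_bases V L"
  shows "\<exists>a\<in>perp V L. \<forall>x\<in>I. a x = f x"
proof -
  obtain w where w: "\<And>e. e \<in> V - I \<Longrightarrow> w e \<in> L"
    "\<And>e. e \<in> V - I \<Longrightarrow> support (w e) \<subseteq> insert e I"
    "\<And>e. e \<in> V - I \<Longrightarrow> w e e = 1"
    using fundamental_vectors[OF I] by metis
  have IV: "I \<subseteq> V" using I by (auto simp: maximal_sets_def)
  define a where "a = (\<lambda>x. if x \<in> I then f x else if x \<in> V then - (\<Sum>i\<in>I. w x i * f i) else 0)"
  have orth: "(\<Sum>x\<in>V. w e x * a x) = 0" if e: "e \<in> V - I" for e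
  proof -
    have "(\<Sum>x\<in>V. w e x * a x) = (\<Sum>x\<in>insert e I. w e x * a x)"
      using w(2)[OF e] e IV fin
      by (intro sum.mono_neutral_right) (auto simp: support_subset_iff)
    also have "\<dots> = a e + (\<Sum>i\<in>I. w e i * f i)"
      using e w(3)[OF e] finite_subset[OF IV fin] by (simp add: a_def)
    also have "\<dots> = 0" using e by (simp add: a_def)
    finally show ?thesis .
  qed
  have "(\<Sum>x\<in>V. u x * a x) = 0" if u: "u \<in> L" for u
  proof -
    let ?s = "\<lambda>x. \<Sum>e\<in>V - I. u e * w e x"
    have "u = ?s"
    proof (rule eq_if_eq_off_basis[OF I u])
      show "?s \<in> L" by (rule sum_mem) (use fin w in auto)
      fix x assume x: "x \<in> V - I"
      have "?s x = (\<Sum>e\<in>V - I. if e = x then u x else 0)"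
        using w x by (intro sum.cong) (auto simp: support_subset_iff)
      then show "u x = ?s x" using x fin by simp
    qed
    then have "(\<Sum>x\<in>V. u x * a x) = (\<Sum>x\<in>V. ?s x * a x)" by metis
    also have "\<dots> = (\<Sum>x\<in>V. \<Sum>e\<in>V - I. u e * (w e x * a x))"
      by (simp add: sum_distrib_right mult.assoc)
    also have "\<dots> = (\<Sum>e\<in>V - I. u e * (\<Sum>x\<in>V. w e x * a x))"
      by (subst sum.swap) (simp add: sum_distrib_left)
    also have "\<dots> = 0" using orth by simp
    finally show ?thesis .
  qed
  then have "a \<in> perp V L" using IV by (auto simp: perp_def vecs_def a_def)
  moreover have "\<forall>x\<in>I. a x = f x" by (simp add: a_def)
  ultimately show ?thesis by blast
qed

text \<open>Spanning is expressed through the dual to match twisted pairs for empty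
  \<open>Y\<close>. For the converse, extend \<open>Z\<close> to a basis \<open>I\<close>: a dual
  vector that is 0 on \<open>Z\<close> and 1 on \<open>I - Z\<close> must vanish, so
  \<open>I = Z\<close>.\<close>

lemma free_basis_iff:
  assumes "Z \<subseteq> V"
  shows "Z \<in> free_bases V L \<longleftrightarrow>
    free_on L Z \<and> (\<forall>a\<in>perp V L. (\<forall>x\<in>Z. a x = 0) \<longrightarrow> a = (\<lambda>_. 0))"
proof safe
  assume Z: "Z \<in> free_bases V L"
  then show "free_on L Z" by (simp add: maximal_sets_def)
  fix a assume a: "a \<in> perp V L" "\<forall>x\<in>Z. a x = 0"
  have "a e = 0" if e: "e \<in> V - Z" for e
  proof -
    obtain v where v: "v \<in> L" "support v \<subseteq> insert e Z" "v e \<noteq> 0"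
      using free_basis_extend[OF Z e] .
    have "(\<Sum>x\<in>V. v x * a x) = (\<Sum>x\<in>{e}. v x * a x)"
      using fin e v(2) a(2) by (intro sum.mono_neutral_right) (auto simp: support_subset_iff)
    then show "a e = 0" using a(1) v by (auto simp: perp_def)
  qed
  then show "a = (\<lambda>_. 0)" using a by (auto simp: perp_def vecs_def fun_eq_iff)
next
  assume free: "free_on L Z" and spanning: "\<forall>a\<in>perp V L. (\<forall>x\<in>Z. a x = 0) \<longrightarrow> a = (\<lambda>_. 0)"
  have "Z \<in> {I. I \<subseteq> V \<and> free_on L I}" using free assms by simp
  from ex_maximal_sets[OF fin _ this] obtain I where I: "I \<in> free_bases V L" "Z \<subseteq> I" by blast
  obtain a where a: "a \<in> perp V L" "\<forall>x\<in>I. a x = (if x \<in> Z then 0 else 1)"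
    using ex_perp_prescribed_on_basis[OF I(1), of "\<lambda>x. if x \<in> Z then 0 else 1"] by blast
  have "\<forall>x\<in>Z. a x = 0" using a(2) I(2) by auto
  then have "a = (\<lambda>_. 0)" using spanning a(1) by blast
  then have "I \<subseteq> Z" using a(2) by (auto split: if_splits)
  with I show "Z \<in> free_bases V L" by auto
qed

end

lemma linear_space_ker_mat:
  assumes "finite V"
  shows "linear_space V (ker_mat R V B)"
proof
  show "(\<lambda>x. u x + c * v x) \<in> ker_mat R V B"
    if "u \<in> ker_mat R V B" "v \<in> ker_mat R V B" for u v c
  proof -
    have "(\<Sum>x\<in>V. B r x * (u x + c * v x)) =
        (\<Sum>x\<in>V. B r x * u x) + c * (\<Sum>x\<in>V. B r x * v x)" for r
      by (simp add: algebra_simps sum.distrib sum_distrib_left)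
    then show ?thesis using that by (simp add: ker_mat_def vecs_def)
  qed
qed (use assms in \<open>auto simp: ker_mat_def vecs_def\<close>)

section \<open>Conjugation on GF(4)\<close>

lemma inv_gf4_0 [simp]: "inv_gf4 0 = 0"
  by (simp add: inv_gf4_def)

lemma inv_gf4_add: "inv_gf4 (x + y) = inv_gf4 x + inv_gf4 y"
  by (cases x rule: gf4_cases; cases y rule: gf4_cases; simp add: inv_gf4_def power2_eq_square)

lemma inv_gf4_mult: "inv_gf4 (x * y) = inv_gf4 x * inv_gf4 y"
  by (simp add: inv_gf4_def power_mult_distrib)

lemma inv_gf4_inv_gf4 [simp]: "inv_gf4 (inv_gf4 x) = x"
  by (cases x rule: gf4_cases; simp add: inv_gf4_def power2_eq_square)

lemma inv_gf4_eq_0_iff [simp]: "inv_gf4 x = 0 \<longleftrightarrow> x = 0"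
  by (simp add: inv_gf4_def)

lemma inv_gf4_sum: "inv_gf4 (\<Sum>x\<in>A. f x) = (\<Sum>x\<in>A. inv_gf4 (f x))"
  by (induction A rule: infinite_finite_induct) (simp_all add: inv_gf4_add)

lemma gf4_add_self [simp]: "x + x = (0 :: gf4)"
  by (cases x rule: gf4_cases; simp add: zero_gf4_def)

lemma gf4_norm: "x * inv_gf4 x \<in> {0, 1}"
  by (cases x rule: gf4_cases; simp add: inv_gf4_def power2_eq_square zero_gf4_def one_gf4_def)

text \<open>For nonzero \<open>y\<close>, \<open>inv_gf4 y\<close> is the inverse of
  \<open>y\<close>, so a product equal to 1 forces \<open>x = y\<close>.\<close>

lemma gf4_mult_inv_in_prime_field:
  assumes "x * inv_gf4 y \<in> {0, 1}"
  shows "x = 0 \<or> y = 0 \<or> x = y"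
  using assms
  by (cases x rule: gf4_cases; cases y rule: gf4_cases;
      simp add: inv_gf4_def power2_eq_square zero_gf4_def one_gf4_def)

lemma gf4_sum_in_prime_field:
  assumes "\<And>x. x \<in> A \<Longrightarrow> f x \<in> {0, 1 :: gf4}"
  shows "(\<Sum>x\<in>A. f x) \<in> {0, 1}"
  using assms
proof (induction A rule: infinite_finite_induct)
  case (insert x A)
  then have "f x \<in> {0, 1}" "(\<Sum>x\<in>A. f x) \<in> {0, 1}" by blast+
  then show ?case using insert.hyps by auto
qed auto

lemma finite_vecs_gf4:
  assumes "finite V"
  shows "finite (vecs V :: ('v \<Rightarrow> gf4) set)"
proof -
  have "finite (UNIV :: gf4 set)" by (rule card_ge_0_finite) (simp add: card_gf4)
  from finite_set_of_finite_funs[OF assms this, of 0]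
  show ?thesis by (simp add: vecs_def)
qed

text \<open>Thus inv(L^perp) is the orthogonal space of \<open>L\<close> under the Hermitian form,
  the shape in which it is used from here on.\<close>

lemma inv_space_perp_iff:
  "a \<in> inv_space (perp V L) \<longleftrightarrow> a \<in> vecs V \<and> (\<forall>u\<in>L. (\<Sum>x\<in>V. u x * inv_gf4 (a x)) = 0)"
proof
  assume "a \<in> inv_space (perp V L)"
  then show "a \<in> vecs V \<and> (\<forall>u\<in>L. (\<Sum>x\<in>V. u x * inv_gf4 (a x)) = 0)"
    by (auto simp: inv_space_def perp_def vecs_def)
next
  assume "a \<in> vecs V \<and> (\<forall>u\<in>L. (\<Sum>x\<in>V. u x * inv_gf4 (a x)) = 0)"
  then have "inv_gf4 \<circ> a \<in> perp V L" by (auto simp: perp_def vecs_def)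
  moreover have "a = inv_gf4 \<circ> (inv_gf4 \<circ> a)" by auto
  ultimately show "a \<in> inv_space (perp V L)" unfolding inv_space_def by blast
qed

section \<open>Twisted pairs\<close>

text \<open>If \<open>B\<close> has full row rank and kernel \<open>L\<close>, the pair \<open>(v, a)\<close> with \<open>a = B\<^sup>* w\<close> encodes a kernel
  vector \<open>(v, w)\<close> of the Hermitian block matrix \<open>[[D, B\<^sup>*], [B, 0]]\<close> restricted to the indices in \<open>Z\<close>
  and all rows of \<open>B\<close>, where \<open>D\<close> is the diagonal indicator matrix of \<open>Y\<close>. Using \<open>a\<close> instead of \<open>w\<close>
  makes the rank assumption unnecessary.\<close>

definition twisted_pairs ::
  "'v set \<Rightarrow> ('v \<Rightarrow> gf4) set \<Rightarrow> 'v set \<Rightarrow> 'v set \<Rightarrow> (('v \<Rightarrow> gf4) \<times> ('v \<Rightarrow> gf4)) set" where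
  "twisted_pairs V L Z Y = {(v, a). v \<in> L \<and> support v \<subseteq> Z \<and>
     a \<in> inv_space (perp V L) \<and> (\<forall>x\<in>Z. a x = proj Y v x)}"

abbreviation zero_pair :: "('v \<Rightarrow> gf4) \<times> ('v \<Rightarrow> gf4)" where
  "zero_pair \<equiv> (\<lambda>_. 0, \<lambda>_. 0)"

definition nonsing :: "'v set \<Rightarrow> ('v \<Rightarrow> gf4) set \<Rightarrow> 'v set \<Rightarrow> 'v set \<Rightarrow> bool" where
  "nonsing V L Z Y \<longleftrightarrow> twisted_pairs V L Z Y \<subseteq> {zero_pair}"

locale gf4_space = linear_space V L for V :: "'v set" and L :: "('v \<Rightarrow> gf4) set"
begin

lemma inv_perp_comb:
  assumes "a \<in> inv_space (perp V L)" and "b \<in> inv_space (perp V L)"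
  shows "(\<lambda>x. a x + c * b x) \<in> inv_space (perp V L)"
proof -
  have "(\<Sum>x\<in>V. u x * inv_gf4 (a x + c * b x)) =
      (\<Sum>x\<in>V. u x * inv_gf4 (a x)) + inv_gf4 c * (\<Sum>x\<in>V. u x * inv_gf4 (b x))" for u
    by (simp add: inv_gf4_add inv_gf4_mult algebra_simps sum.distrib sum_distrib_left)
  then show ?thesis using assms by (simp add: inv_space_perp_iff vecs_def)
qed

text \<open>For empty \<open>Y\<close> the conditions on \<open>v\<close> and \<open>a\<close> are
  independent; pairing each with zero separates them into the two halves of
  \<open>free_basis_iff\<close>.\<close>

lemma nonsing_empty_iff:
  assumes "Z \<subseteq> V"
  shows "nonsing V L Z {} \<longleftrightarrow> Z \<in> free_bases V L"
proof -
  have zero_inv: "(\<lambda>_. 0) \<in> inv_space (perp V L)"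
    by (simp add: inv_space_perp_iff vecs_def)
  have "nonsing V L Z {} \<longleftrightarrow> free_on L Z \<and>
      (\<forall>a\<in>inv_space (perp V L). (\<forall>x\<in>Z. a x = 0) \<longrightarrow> a = (\<lambda>_. 0))"
  proof safe
    assume nonsing: "nonsing V L Z {}"
    have pair: "v = (\<lambda>_. 0) \<and> a = (\<lambda>_. 0)"
      if "v \<in> L" "support v \<subseteq> Z" "a \<in> inv_space (perp V L)" "\<forall>x\<in>Z. a x = 0" for v a
    proof -
      have "(v, a) \<in> twisted_pairs V L Z {}" using that by (simp add: twisted_pairs_def proj_def)
      then show ?thesis using nonsing by (auto simp: nonsing_def)
    qed
    show "free_on L Z" unfolding free_on_def using pair[OF _ _ zero_inv] by blast
    show "a = (\<lambda>_. 0)" if "a \<in> inv_space (perp V L)" "\<forall>x\<in>Z. a x = 0" for a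
      using pair[OF zero _ that] by (simp add: support_def)
  next
    assume "free_on L Z" "\<forall>a\<in>inv_space (perp V L). (\<forall>x\<in>Z. a x = 0) \<longrightarrow> a = (\<lambda>_. 0)"
    then show "nonsing V L Z {}"
      unfolding nonsing_def twisted_pairs_def free_on_def proj_def by force
  qed
  also have "\<dots> \<longleftrightarrow> free_on L Z \<and> (\<forall>a\<in>perp V L. (\<forall>x\<in>Z. a x = 0) \<longrightarrow> a = (\<lambda>_. 0))"
    by (simp add: inv_space_def fun_eq_iff)
  finally show ?thesis using free_basis_iff[OF assms] by simp
qed

section \<open>Adding one element to \<open>Y\<close>\<close>

lemma nonsing_insert_outside:
  assumes "y \<notin> Z"
  shows "nonsing V L Z (insert y Y) \<longleftrightarrow> nonsing V L Z Y"
proof -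
  have "\<forall>x\<in>Z. proj (insert y Y) v x = proj Y v x" for v :: "'v \<Rightarrow> gf4"
    using assms by (auto simp: proj_def)
  then show ?thesis by (simp add: nonsing_def twisted_pairs_def)
qed

text \<open>For \<open>y\<close> in \<open>Z\<close> but not in \<open>Y\<close>, omitting the
  condition at \<open>y\<close> gives one space in which the twisted pairs for \<open>Z\<close> and
  \<open>Y\<close>, for \<open>Z - {y}\<close> and \<open>Y\<close>, and for \<open>Z\<close> and
  \<open>insert y Y\<close> are each cut out by a single linear condition.\<close>

definition near_pairs :: "'v \<Rightarrow> 'v set \<Rightarrow> 'v set \<Rightarrow> (('v \<Rightarrow> gf4) \<times> ('v \<Rightarrow> gf4)) set" where
  "near_pairs y Z Y = {(v, a). v \<in> L \<and> support v \<subseteq> Z \<and>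
     a \<in> inv_space (perp V L) \<and> (\<forall>x\<in>Z - {y}. a x = proj Y v x)}"

lemma near_pairs_comb:
  assumes "p \<in> near_pairs y Z Y" and "q \<in> near_pairs y Z Y"
  shows "(\<lambda>x. fst p x + c * fst q x, \<lambda>x. snd p x + c * snd q x) \<in> near_pairs y Z Y"
  using assms
  by (auto simp: near_pairs_def comb inv_perp_comb support_subset_iff proj_def)

text \<open>There are \<open>card V\<close> degrees of freedom for a pair but only \<open>card V - 1\<close> linear conditions.\<close>

lemma ex_near_pair:
  assumes "Z \<subseteq> V" and "y \<in> Z"
  shows "\<exists>p\<in>near_pairs y Z Y. p \<noteq> zero_pair"
proof -
  let ?C = "inv_space (perp V L)"
  obtain I where I: "I \<in> free_bases V L"
    using ex_maximal_sets[OF fin, of "{I. I \<subseteq> V \<and> free_on L I}" "{}"]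
    by (auto simp: free_on_def support_def)
  have IV: "I \<subseteq> V" using I by (auto simp: maximal_sets_def)
  obtain F where F: "\<And>f. F f \<in> L" "\<And>f x. x \<in> V - I \<Longrightarrow> F f x = f x"
    using ex_prescribed_off_basis[OF I] by metis
  have "\<exists>a\<in>?C. \<forall>x\<in>I. a x = f x" for f
  proof -
    obtain b where "b \<in> perp V L" "\<forall>x\<in>I. b x = inv_gf4 (f x)"
      using ex_perp_prescribed_on_basis[OF I, of "\<lambda>x. inv_gf4 (f x)"] by blast
    then show ?thesis by (intro bexI[of _ "inv_gf4 \<circ> b"]) (auto simp: inv_space_def)
  qed
  then obtain G where G: "\<And>f. G f \<in> ?C" "\<And>f x. x \<in> I \<Longrightarrow> G f x = f x" by metis
  \<comment> \<open>\<open>f\<close> prescribes \<open>v\<close> off \<open>I\<close> and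
    \<open>a\<close> on \<open>I\<close>, and \<open>h f\<close> collects what must vanish for a
    near pair. \<open>F\<close> and \<open>G\<close> come from choice and need not be linear, so
    instead of a kernel vector of \<open>h\<close> a collision \<open>h f = h g\<close> is used, and
    differences are taken.\<close>
  define h where "h f = (\<lambda>x. if x \<in> V - {y} then if x \<in> Z then G f x - proj Y (F f) x else F f x
    else 0)" for f
  have "vecs (V - {y}) \<subseteq> (vecs V :: ('v \<Rightarrow> gf4) set)" by (auto simp: vecs_def)
  moreover have "(\<lambda>x. if x = y then 1 else 0 :: gf4) \<in> vecs V - vecs (V - {y})"
    using assms by (auto simp: vecs_def)
  ultimately have "(vecs (V - {y}) :: ('v \<Rightarrow> gf4) set) \<subset> vecs V" by blast
  then have "card (vecs (V - {y}) :: ('v \<Rightarrow> gf4) set) < card (vecs V :: ('v \<Rightarrow> gf4) set)"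
    by (intro psubset_card_mono finite_vecs_gf4 fin)
  moreover have "h ` vecs V \<subseteq> vecs (V - {y})" by (auto simp: h_def vecs_def)
  ultimately have "\<not> inj_on h (vecs V)"
    using card_inj_on_le[of h "vecs V" "vecs (V - {y})"] finite_vecs_gf4[of "V - {y}"] fin
    by auto
  then obtain f g where fg: "f \<in> vecs V" "g \<in> vecs V" "h f = h g" "f \<noteq> g"
    by (auto simp: inj_on_def)
  define v where "v = (\<lambda>x. F f x + (- 1) * F g x)"
  define a where "a = (\<lambda>x. G f x + (- 1) * G g x)"
  have "v \<in> L" "a \<in> ?C" unfolding v_def a_def by (intro comb inv_perp_comb F G)+
  moreover have "v x = 0" if "x \<notin> Z" for x
  proof (cases "x \<in> V")
    case True
    then show ?thesis using that assms(2) fun_cong[OF fg(3), of x]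
      by (auto simp: h_def v_def split: if_splits)
  next
    case False
    then show ?thesis using \<open>v \<in> L\<close> by (simp add: eq_0_outside)
  qed
  moreover have "a x = proj Y v x" if "x \<in> Z - {y}" for x
  proof -
    have "G f x - proj Y (F f) x = G g x - proj Y (F g) x"
      using that assms(1) fun_cong[OF fg(3), of x] by (auto simp: h_def)
    then show ?thesis by (auto simp: a_def v_def proj_def algebra_simps)
  qed
  ultimately have "(v, a) \<in> near_pairs y Z Y"
    by (simp add: near_pairs_def support_subset_iff)
  moreover have "(v, a) \<noteq> zero_pair"
  proof
    assume eq: "(v, a) = zero_pair"
    then have "F f x = F g x" "G f x = G g x" for x
      by (auto simp: v_def a_def fun_eq_iff)
    then have "f x = g x" if "x \<in> V" for x
      using that F(2)[of x f] F(2)[of x g] G(2)[of x f] G(2)[of x g] by (cases "x \<in> I") auto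
    moreover have "f x = g x" if "x \<notin> V" for x using that fg(1,2) by (simp add: vecs_def)
    ultimately have "f = g" by blast
    with fg(4) show False ..
  qed
  ultimately show ?thesis by blast
qed

text \<open>Orthogonality of \<open>v\<close> and \<open>a\<close> turns \<open>v y * inv_gf4 (a y)\<close> into a sum of norms.\<close>

lemma near_pair_trichotomy:
  assumes "Z \<subseteq> V" and "y \<in> Z" and "(v, a) \<in> near_pairs y Z Y"
  shows "v y = 0 \<or> a y = 0 \<or> v y = a y"
proof -
  let ?s = "\<Sum>x\<in>V - {y}. v x * inv_gf4 (a x)"
  \<comment> \<open>Such a term is 0 unless \<open>x\<close> lies in both \<open>Z\<close> and
    \<open>Y\<close>, where \<open>a x = v x\<close> makes it a norm.\<close>
  have "v x * inv_gf4 (a x) \<in> {0, 1}" if "x \<in> V - {y}" for x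
    using that assms(3) gf4_norm[of "v x"]
    by (cases "x \<in> Z") (auto simp: near_pairs_def support_subset_iff proj_def)
  then have s: "?s \<in> {0, 1}" by (rule gf4_sum_in_prime_field)
  have "0 = (\<Sum>x\<in>V. v x * inv_gf4 (a x))"
    using assms(3) by (simp add: near_pairs_def inv_space_perp_iff)
  also have "\<dots> = v y * inv_gf4 (a y) + ?s"
    using fin assms by (subst sum.remove[of _ y]) auto
  finally have "v y * inv_gf4 (a y) = - ?s" by (simp add: eq_neg_iff_add_eq_0)
  then have "v y * inv_gf4 (a y) \<in> {0, 1}" using s by (auto simp: uminus_gf4_def)
  then show ?thesis by (rule gf4_mult_inv_in_prime_field)
qed

text \<open>If \<open>h\<close> is nonzero at both given solutions \<open>p\<close> and
  \<open>q\<close>, cancel it between them. The combination cannot be zero: otherwise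
  \<open>f q = 0\<close> besides \<open>g q = 0\<close>, and \<open>dep\<close> would give
  \<open>h q = 0\<close>.\<close>

lemma near_pairs_third_functional:
  fixes f g h :: "('v \<Rightarrow> gf4) \<times> ('v \<Rightarrow> gf4) \<Rightarrow> gf4"
  assumes lin: "\<And>k p q c. k \<in> {f, g, h} \<Longrightarrow>
      k (\<lambda>x. fst p x + c * fst q x, \<lambda>x. snd p x + c * snd q x) = k p + c * k q"
    and dep: "\<And>p. f p = 0 \<Longrightarrow> g p = 0 \<Longrightarrow> h p = 0"
    and ex_f: "\<exists>p\<in>near_pairs y Z Y. p \<noteq> zero_pair \<and> f p = 0"
    and ex_g: "\<exists>p\<in>near_pairs y Z Y. p \<noteq> zero_pair \<and> g p = 0"
  shows "\<exists>r\<in>near_pairs y Z Y. r \<noteq> zero_pair \<and> h r = 0"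
proof (rule ccontr)
  assume neg: "\<not> ?thesis"
  obtain p where p: "p \<in> near_pairs y Z Y" "p \<noteq> zero_pair" "f p = 0" using ex_f by blast
  obtain q where q: "q \<in> near_pairs y Z Y" "q \<noteq> zero_pair" "g q = 0" using ex_g by blast
  have nz: "h p \<noteq> 0" "h q \<noteq> 0" using neg p q by blast+
  define c where "c = - h p / h q"
  define r where "r = (\<lambda>x. fst p x + c * fst q x, \<lambda>x. snd p x + c * snd q x)"
  have k: "k r = k p + c * k q" if "k \<in> {f, g, h}" for k
    unfolding r_def using that by (rule lin)
  have f0: "f zero_pair = 0"
    using lin[of f zero_pair 1 zero_pair] by simp
  have "r \<noteq> zero_pair"
  proof
    assume "r = zero_pair"
    then have "c * f q = 0" using k[of f] p(3) f0 by simp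
    then have "f q = 0" using nz by (simp add: c_def)
    with dep[of q] q(3) nz show False by blast
  qed
  moreover have "h r = 0" using k[of h] nz by (simp add: c_def)
  moreover have "r \<in> near_pairs y Z Y" unfolding r_def by (rule near_pairs_comb[OF p(1) q(1)])
  ultimately show False using neg by blast
qed

text \<open>The three singularity conditions restrict near pairs by \<open>a y = 0\<close>, \<open>v y = 0\<close> and \<open>v y = a y\<close>.
  By the trichotomy at least one of them has a nonzero solution, and if two have one, so has the third.
  Hence zero or two of the three are nonsingular; this replaces the expansion of a determinant.\<close>

lemma nonsing_insert:
  assumes "Z \<subseteq> V" and "y \<in> Z" and "y \<notin> Y"
  shows "nonsing V L Z (insert y Y) \<longleftrightarrow> (nonsing V L Z Y \<noteq> nonsing V L (Z - {y}) Y)"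
proof -
  let ?U = "near_pairs y Z Y"
  let ?f = "\<lambda>p :: ('v \<Rightarrow> gf4) \<times> ('v \<Rightarrow> gf4). snd p y"
  let ?g = "\<lambda>p :: ('v \<Rightarrow> gf4) \<times> ('v \<Rightarrow> gf4). fst p y"
  let ?h = "\<lambda>p :: ('v \<Rightarrow> gf4) \<times> ('v \<Rightarrow> gf4). fst p y - snd p y"
  let ?S = "\<lambda>k. \<exists>p\<in>?U. p \<noteq> zero_pair \<and> k p = (0 :: gf4)"
  have "twisted_pairs V L Z Y = {p \<in> ?U. ?f p = 0}"
    using assms by (auto simp: twisted_pairs_def near_pairs_def proj_def)
  then have f: "nonsing V L Z Y \<longleftrightarrow> \<not> ?S ?f" unfolding nonsing_def by blast
  have "twisted_pairs V L (Z - {y}) Y = {p \<in> ?U. ?g p = 0}"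
    using assms by (auto simp: twisted_pairs_def near_pairs_def support_def)
  then have g: "nonsing V L (Z - {y}) Y \<longleftrightarrow> \<not> ?S ?g" unfolding nonsing_def by blast
  have "twisted_pairs V L Z (insert y Y) = {p \<in> ?U. ?h p = 0}"
    using assms by (auto simp: twisted_pairs_def near_pairs_def proj_def)
  then have h: "nonsing V L Z (insert y Y) \<longleftrightarrow> \<not> ?S ?h" unfolding nonsing_def by blast
  have "?S ?f \<or> ?S ?g \<or> ?S ?h"
  proof -
    obtain p where "p \<in> ?U" "p \<noteq> zero_pair" using ex_near_pair[OF assms(1,2)] by blast
    then show ?thesis using near_pair_trichotomy[OF assms(1,2), of "fst p" "snd p" Y] by auto
  qed
  moreover have "?S ?h" if "?S ?f" "?S ?g"
    by (rule near_pairs_third_functional[OF _ _ that]) (auto simp: algebra_simps)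
  moreover have "?S ?g" if "?S ?f" "?S ?h"
    by (rule near_pairs_third_functional[OF _ _ that]) (auto simp: algebra_simps)
  moreover have "?S ?f" if "?S ?g" "?S ?h"
    by (rule near_pairs_third_functional[OF _ _ that]) (auto simp: algebra_simps)
  ultimately show ?thesis unfolding f g h by argo
qed

text \<open>For \<open>y\<close> in \<open>Z\<close>, the interval for \<open>insert y Y\<close>
  splits by whether \<open>W\<close> contains \<open>y\<close>, so parities add, as in the exclusive
  or of \<open>nonsing_insert\<close>. \<open>Z\<close> is arbitrary because the induction
  hypothesis is needed at both \<open>Z\<close> and \<open>Z - {y}\<close>.\<close>

lemma odd_bases_iff_nonsing:
  assumes "finite Y" and "Z \<subseteq> V"
  shows "odd (card {W \<in> free_bases V L. Z - Y \<subseteq> W \<and> W \<subseteq> Z}) \<longleftrightarrow> nonsing V L Z Y"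
  using assms
proof (induction Y arbitrary: Z rule: finite_induct)
  case empty
  have "{W \<in> free_bases V L. Z - {} \<subseteq> W \<and> W \<subseteq> Z} = (if Z \<in> free_bases V L then {Z} else {})"
    by auto
  then show ?case using nonsing_empty_iff[OF empty.prems] by simp
next
  case (insert y Y)
  let ?D = "\<lambda>Z Y. {W \<in> free_bases V L. Z - Y \<subseteq> W \<and> W \<subseteq> Z}"
  show ?case
  proof (cases "y \<in> Z")
    case False
    then have "?D Z (insert y Y) = ?D Z Y" by auto
    then show ?thesis using insert.IH[OF insert.prems] nonsing_insert_outside[OF False] by simp
  next
    case True
    have "Z - insert y Y \<subseteq> W \<and> W \<subseteq> Z \<longleftrightarrow>
        (Z - Y \<subseteq> W \<and> W \<subseteq> Z) \<or> (Z - {y} - Y \<subseteq> W \<and> W \<subseteq> Z - {y})" for W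
      by (cases "y \<in> W") auto
    then have "?D Z (insert y Y) = ?D Z Y \<union> ?D (Z - {y}) Y" by blast
    moreover have "\<not> (Z - Y \<subseteq> W \<and> W \<subseteq> Z - {y})" for W using True insert.hyps(2) by blast
    then have "?D Z Y \<inter> ?D (Z - {y}) Y = {}" by blast
    moreover have "finite (?D Z' Y)" for Z'
      by (rule finite_subset[of _ "Pow V"]) (auto simp: maximal_sets_def fin)
    ultimately have c: "card (?D Z (insert y Y)) = card (?D Z Y) + card (?D (Z - {y}) Y)"
      by (simp only: card_Un_disjoint)
    have o1: "odd (card (?D Z Y)) \<longleftrightarrow> nonsing V L Z Y" by (rule insert.IH[OF insert.prems])
    have o2: "odd (card (?D (Z - {y}) Y)) \<longleftrightarrow> nonsing V L (Z - {y}) Y"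
      by (rule insert.IH) (use insert.prems in auto)
    show ?thesis
      unfolding c nonsing_insert[OF insert.prems True insert.hyps(2)] o1[symmetric] o2[symmetric]
      by simp
  qed
qed

section \<open>Nonsingular sets and bases of the matroid of \<open>BC V L Y\<close>\<close>

lemma nonsing_imp_free_on_BC:
  assumes "nonsing V L Z Y"
  shows "free_on (BC V L Y) Z"
  unfolding free_on_def
proof (intro ballI impI)
  fix v assume "v \<in> BC V L Y" "support v \<subseteq> Z"
  then have "(v, proj Y v) \<in> twisted_pairs V L Z Y" by (simp add: twisted_pairs_def BC_def)
  with assms show "v = (\<lambda>_. 0)" by (auto simp: nonsing_def)
qed

text \<open>Once \<open>a = proj Y v\<close> holds off \<open>Z\<close> too, \<open>v\<close> lies
  in \<open>BC V L Y\<close> and freeness makes it zero. For \<open>e\<close> off \<open>Z\<close>,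
  maximality supplies \<open>k\<close>; the difference of \<open>a\<close> and
  \<open>proj Y v\<close> is Hermitian-orthogonal to \<open>k\<close> and vanishes on
  \<open>Z\<close>, so only the term at \<open>e\<close> survives.\<close>

lemma free_basis_BC_imp_nonsing:
  assumes "Y \<subseteq> V" and Z: "Z \<in> free_bases V (BC V L Y)"
  shows "nonsing V L Z Y"
  unfolding nonsing_def
proof clarify
  fix v a assume "(v, a) \<in> twisted_pairs V L Z Y"
  then have v: "v \<in> L" "support v \<subseteq> Z" and a: "a \<in> inv_space (perp V L)"
    and eq: "\<And>x. x \<in> Z \<Longrightarrow> a x = proj Y v x"
    by (auto simp: twisted_pairs_def)
  have "a e = proj Y v e" if e: "e \<in> V - Z" for e
  proof -
    obtain k where k: "k \<in> BC V L Y" "support k \<subseteq> insert e Z" "k e \<noteq> 0"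
      using free_basis_extend[OF Z e] .
    then have kL: "k \<in> L" and kY: "proj Y k \<in> inv_space (perp V L)" by (auto simp: BC_def)
    \<comment> \<open>Hermitian symmetry moves the projection from \<open>v\<close> to
      \<open>k\<close>, whose projection is orthogonal to \<open>L\<close>.\<close>
    have "(\<Sum>x\<in>V. k x * inv_gf4 (proj Y v x)) = inv_gf4 (\<Sum>x\<in>V. v x * inv_gf4 (proj Y k x))"
      unfolding inv_gf4_sum
      by (intro sum.cong) (auto simp: proj_def inv_gf4_mult mult.commute)
    also have "\<dots> = 0" using kY v(1) by (simp add: inv_space_perp_iff)
    finally have "(\<Sum>x\<in>V. k x * inv_gf4 (proj Y v x)) = 0" .
    moreover have "(\<Sum>x\<in>V. k x * inv_gf4 (a x)) = 0"
      using a kL by (simp add: inv_space_perp_iff)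
    \<comment> \<open>In characteristic 2 this sum of \<open>a\<close> and \<open>proj Y v\<close>
      is their difference.\<close>
    ultimately have "(\<Sum>x\<in>V. k x * inv_gf4 (a x + proj Y v x)) = 0"
      by (simp add: inv_gf4_add distrib_left sum.distrib)
    moreover have "(\<Sum>x\<in>V. k x * inv_gf4 (a x + proj Y v x)) =
        (\<Sum>x\<in>{e}. k x * inv_gf4 (a x + proj Y v x))"
      using fin e k(2) eq
      by (intro sum.mono_neutral_right) (auto simp: support_subset_iff)
    ultimately have "a e + proj Y v e = 0" using k(3) by simp
    then show ?thesis by (simp add: add_eq_0_iff uminus_gf4_def)
  qed
  moreover have "a x = proj Y v x" if "x \<notin> V" for x
    using that a assms(1) by (auto simp: inv_space_perp_iff vecs_def proj_def)
  ultimately have "a = proj Y v" using eq by (auto simp: fun_eq_iff)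
  then have "v \<in> BC V L Y" using v(1) a by (simp add: BC_def)
  then have "v = (\<lambda>_. 0)" using Z v(2) by (auto simp: maximal_sets_def free_on_def)
  with \<open>a = proj Y v\<close> show "v = (\<lambda>_. 0) \<and> a = (\<lambda>_. 0)" by (auto simp: proj_def)
qed

text \<open>A sandwich: nonsingular sets are free and maximal free sets are nonsingular, so both
  families have the same maximal members.\<close>

lemma maximal_nonsing:
  assumes "Y \<subseteq> V"
  shows "maximal_sets {Z. Z \<subseteq> V \<and> nonsing V L Z Y} = free_bases V (BC V L Y)"
proof -
  let ?N = "{Z. Z \<subseteq> V \<and> nonsing V L Z Y}" and ?F = "{Z. Z \<subseteq> V \<and> free_on (BC V L Y) Z}"
  have NF: "?N \<subseteq> ?F" using nonsing_imp_free_on_BC by blast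
  have FN: "maximal_sets ?F \<subseteq> ?N"
    using free_basis_BC_imp_nonsing[OF assms] by (auto simp: maximal_sets_def)
  show ?thesis
  proof
    show "maximal_sets ?F \<subseteq> maximal_sets ?N"
      using NF FN unfolding maximal_sets_def by blast
    show "maximal_sets ?N \<subseteq> maximal_sets ?F"
    proof
      fix Z assume Z: "Z \<in> maximal_sets ?N"
      then have "Z \<in> ?F" using NF by (auto simp: maximal_sets_def)
      from ex_maximal_sets[OF fin _ this] obtain W where W: "W \<in> maximal_sets ?F" "Z \<subseteq> W"
        by blast
      then have "W \<in> ?N" using FN by blast
      then have "W = Z" using Z W(2) by (auto simp: maximal_sets_def)
      with W(1) show "Z \<in> maximal_sets ?F" by simp
    qed
  qed
qed

end

theorem theorem3:
  fixes M :: "'v set_system"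
    and V Y :: "'v set"
    and R :: "'r set"
    and B :: "'r \<Rightarrow> 'v \<Rightarrow> gf4"
  assumes "quaternary M"
    and "ground M = V"
    and "representation R B M"
    and "Y \<subseteq> V"
  shows "matroid_of_space V (BC V (ker_mat R V B) Y) = max_sys (loop_compl M Y)"
proof -
  let ?L = "ker_mat R V B"
  have fin: "finite V" using assms(1,2) by (simp add: quaternary_def matroid_def)
  interpret gf4_space V ?L
    using linear_space_ker_mat[OF fin] by (simp add: gf4_space_def)
  have "column_matroid R V B = M" using assms(2,3) by (simp add: representation_def)
  then have D: "members M = free_bases V ?L" using members_column_matroid[OF fin] by metis
  have "members (loop_compl M Y) = {Z. Z \<subseteq> V \<and> nonsing V ?L Z Y}"
    using odd_bases_iff_nonsing[OF finite_subset[OF assms(4) fin]]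
    by (auto simp: loop_compl_def assms(2) D)
  then have "members (max_sys (loop_compl M Y)) = free_bases V (BC V ?L Y)"
    using maximal_nonsing[OF assms(4)] by (simp add: max_sys_def)
  moreover have "BC V ?L Y \<subseteq> vecs V" using sub by (auto simp: BC_def)
  then have "members (matroid_of_space V (BC V ?L Y)) = free_bases V (BC V ?L Y)"
    by (rule members_matroid_of_space[OF fin])
  moreover have "ground (max_sys (loop_compl M Y)) = V"
    by (simp add: max_sys_def loop_compl_def assms(2))
  moreover have "ground (matroid_of_space V (BC V ?L Y)) = V"
    by (simp add: matroid_of_space_def matroid_of_circuits_def)
  ultimately show ?thesis by (simp add: prod_eq_iff)
qed

end
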